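(* (Blatz–Ko–Ogden model, hyperbolicity.) Let $\lambda,\mu,\rho_0>0$, $\beta=\frac{\lambda}{2\mu}$, $f\in(0,1)$, and for $\Gamma>-1$ let $$P(\Gamma)=\frac{\mu(1+\Gamma)}{\rho_0}\Big\{f\big[1-(1+\Gamma)^{-2\beta-2}\big]+\frac{1-f}{(1+\Gamma)^4}\big[(1+\Gamma)^{2\beta+2}-1\big]\Big\}.$$ (i) If $\beta\ge\frac12$, the model is hyperbolic for all $\Gamma>-1$. (ii) If $0<\beta<\frac12$, the hyperbolicity condition requires a restriction for $f$ of the form $f>f_\beta$, where $f_\beta$ is a certain number in $(0,1)$ determined according to $$f_\beta=\max_{s>s_\beta}Q(s,\beta),$$ where $$Q(s,\beta)=\frac{s^{2\beta}[(1-2\beta)s^{2\beta+2}-3]}{s^2[(1+2\beta)+s^{2\beta+2}]+s^{2\beta}[(1-2\beta)s^{2\beta+2}-3]},\qquad s_\beta=\Big(\frac{3}{1-2\beta}\Big)^{\frac1{2\beta+2}};$$ here $$f_\beta\le\frac{1-2\beta}{1-2\beta+s_\beta^{2-2\beta}}.$$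
   Context: The variable $s$ stands for $1+\Gamma$. The p-system $V_t-(P(\Gamma))_X=0$, $\Gamma_t-V_X=0$ with $\Gamma>-1$ is (strictly) hyperbolic where $P'(\Gamma)>0$; the hyperbolicity condition is $P'(\Gamma)>0$ for all $\Gamma>-1$. *)

theory Defs
  imports "HOL-Analysis.Analysis"
begin

text \<open>
  Hyperbolicity of the p-system \<open>V\<^sub>t - (P \<Gamma>)\<^sub>X = 0\<close>, \<open>\<Gamma>\<^sub>t - V\<^sub>X = 0\<close> at the state \<open>\<Gamma>\<close>.
  Differentiability is demanded explicitly because \<^const>\<open>deriv\<close> is a total function.
\<close>

definition p_system_hyperbolic_at :: "(real \<Rightarrow> real) \<Rightarrow> real \<Rightarrow> bool" where
  "p_system_hyperbolic_at P \<Gamma> \<longleftrightarrow> P field_differentiable (at \<Gamma>) \<and> deriv P \<Gamma> > 0"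

definition hyperbolicity_condition :: "(real \<Rightarrow> real) \<Rightarrow> bool" where
  "hyperbolicity_condition P \<longleftrightarrow> (\<forall>\<Gamma>>-1. p_system_hyperbolic_at P \<Gamma>)"

definition BKO_P :: "real \<Rightarrow> real \<Rightarrow> real \<Rightarrow> real \<Rightarrow> real \<Rightarrow> real" where
  "BKO_P \<mu> \<rho>\<^sub>0 \<beta> f \<Gamma> =
     \<mu> * (1 + \<Gamma>) / \<rho>\<^sub>0 *
       (f * (1 - (1 + \<Gamma>) powr (-2 * \<beta> - 2))
        + (1 - f) / (1 + \<Gamma>) ^ 4 * ((1 + \<Gamma>) powr (2 * \<beta> + 2) - 1))"

definition BKO_Q :: "real \<Rightarrow> real \<Rightarrow> real" where
  "BKO_Q s \<beta> =
     s powr (2 * \<beta>) * ((1 - 2 * \<beta>) * s powr (2 * \<beta> + 2) - 3) /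
     (s ^ 2 * ((1 + 2 * \<beta>) + s powr (2 * \<beta> + 2))
      + s powr (2 * \<beta>) * ((1 - 2 * \<beta>) * s powr (2 * \<beta> + 2) - 3))"

definition BKO_s :: "real \<Rightarrow> real" where
  "BKO_s \<beta> = (3 / (1 - 2 * \<beta>)) powr (1 / (2 * \<beta> + 2))"

text \<open>
  The maximum of \<open>Q(s, \<beta>)\<close> over the infinite range \<open>s > s\<^sub>\<beta>\<close>, as a greatest element
  (\<^const>\<open>Max\<close> is meaningful for finite sets only). As with any description operator, the value is
  the maximum only if one exists; that it is attained has to be asserted separately.
\<close>

definition BKO_f :: "real \<Rightarrow> real" where
  "BKO_f \<beta> = (GREATEST y. y \<in> (\<lambda>s. BKO_Q s \<beta>) ` {BKO_s \<beta><..})"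

end

(*
  With s = 1 + \<Gamma>, the product P'(\<Gamma>) s^(2\<beta>+4) is a positive multiple of f A(s) - (1 - f) B(s), where
  A > 0, B is positive exactly for s > s_\<beta> (if \<beta> < 1/2), and Q = B / (A + B). So P' > 0 holds
  automatically where B \<le> 0 and amounts to f > Q(s) elsewhere. Since B / A < (1 - 2\<beta>) s^(2\<beta>-2),
  Q is dominated by a decreasing function that vanishes at infinity; as Q(s_\<beta>) = 0 and Q > 0 on
  (s_\<beta>, \<infinity>), the maximum is attained, and the dominating function at s_\<beta> bounds it.
*)
theory Submission imports Defs begin

section \<open>Numerator and denominator of Q\<close>

definition BKO_A :: "real \<Rightarrow> real \<Rightarrow> real" where
  "BKO_A \<beta> s = s ^ 2 * ((1 + 2 * \<beta>) + s powr (2 * \<beta> + 2))"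

definition BKO_B :: "real \<Rightarrow> real \<Rightarrow> real" where
  "BKO_B \<beta> s = s powr (2 * \<beta>) * ((1 - 2 * \<beta>) * s powr (2 * \<beta> + 2) - 3)"

lemma BKO_Q_eq: "BKO_Q s \<beta> = BKO_B \<beta> s / (BKO_A \<beta> s + BKO_B \<beta> s)"
  by (simp add: BKO_Q_def BKO_A_def BKO_B_def)

lemma BKO_A_pos: "s > 0 \<Longrightarrow> \<beta> > 0 \<Longrightarrow> BKO_A \<beta> s > 0"
  by (simp add: BKO_A_def add_pos_pos)

section \<open>The derivative of P and the inequality equivalent to hyperbolicity\<close>

lemma BKO_P_eq_powr:
  assumes "\<Gamma> > -1"
  shows "BKO_P \<mu> \<rho> \<beta> f \<Gamma> = \<mu> / \<rho> *
    (f * ((1 + \<Gamma>) - (1 + \<Gamma>) powr (-2 * \<beta> - 1))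
     + (1 - f) * ((1 + \<Gamma>) powr (2 * \<beta> - 1) - (1 + \<Gamma>) powr (-3)))"
proof -
  define s where "s = 1 + \<Gamma>"
  have s: "s > 0" using assms by (simp add: s_def)
  \<comment> \<open>Since \<open>s > 0\<close>, the natural power \<open>s ^ 4\<close> is also a
    real power, so each summand of P collapses to a single \<open>powr\<close> that can be
    differentiated termwise.\<close>
  have e: "s powr (-2 * \<beta> - 1) = s * s powr (-2 * \<beta> - 2)"
    "s powr (2 * \<beta> - 1) = s / s ^ 4 * s powr (2 * \<beta> + 2)"
    "s powr (-3) = s / s ^ 4"
  proof -
    show "s powr (-2 * \<beta> - 1) = s * s powr (-2 * \<beta> - 2)"
      using s powr_mult_base[of s "-2 * \<beta> - 2"] by (simp add: minus_diff_commute)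
    have "s powr (-3) = s / s powr 4"
      using s powr_diff[of s 1 4] by simp
    then show 3: "s powr (-3) = s / s ^ 4"
      using s powr_realpow[of s 4] by simp
    show "s powr (2 * \<beta> - 1) = s / s ^ 4 * s powr (2 * \<beta> + 2)"
      unfolding 3[symmetric] powr_add[symmetric] by simp
  qed
  show ?thesis
    unfolding BKO_P_def s_def[symmetric] e
    by (simp add: algebra_simps add_divide_distrib diff_divide_distrib)
qed

lemma BKO_P_has_derivative:
  assumes "\<Gamma> > -1"
  shows "(BKO_P \<mu> \<rho> \<beta> f has_field_derivative
    \<mu> / \<rho> * (f * (1 + (2 * \<beta> + 1) * (1 + \<Gamma>) powr (-2 * \<beta> - 2))
     + (1 - f) * ((2 * \<beta> - 1) * (1 + \<Gamma>) powr (2 * \<beta> - 2) + 3 * (1 + \<Gamma>) powr (-4)))) (at \<Gamma>)"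
\<comment> \<open>The expansion into powers is available on the open half-line \<Gamma> > -1, so its
  derivative carries over to P there.\<close>
proof (rule has_field_derivative_transform_within_open)
  show "((\<lambda>\<Gamma>. \<mu> / \<rho> *
    (f * ((1 + \<Gamma>) - (1 + \<Gamma>) powr (-2 * \<beta> - 1))
     + (1 - f) * ((1 + \<Gamma>) powr (2 * \<beta> - 1) - (1 + \<Gamma>) powr (-3)))) has_field_derivative
    \<mu> / \<rho> * (f * (1 + (2 * \<beta> + 1) * (1 + \<Gamma>) powr (-2 * \<beta> - 2))
     + (1 - f) * ((2 * \<beta> - 1) * (1 + \<Gamma>) powr (2 * \<beta> - 2) + 3 * (1 + \<Gamma>) powr (-4)))) (at \<Gamma>)"
    by (rule DERIV_cmult) (use assms in \<open>auto intro!: derivative_eq_intros simp: algebra_simps\<close>)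
  show "open {-1::real<..}" "\<Gamma> \<in> {-1<..}" using assms by auto
qed (simp add: BKO_P_eq_powr)

lemma p_system_hyperbolic_at_BKO_P_iff:
  assumes "\<Gamma> > -1" "\<mu> > 0" "\<rho> > 0"
  shows "p_system_hyperbolic_at (BKO_P \<mu> \<rho> \<beta> f) \<Gamma> \<longleftrightarrow>
    f * BKO_A \<beta> (1 + \<Gamma>) > (1 - f) * BKO_B \<beta> (1 + \<Gamma>)"
proof -
  define s where "s = 1 + \<Gamma>"
  have s: "s > 0" using assms by (simp add: s_def)
  define D where "D = f * (1 + (2 * \<beta> + 1) * s powr (-2 * \<beta> - 2))
     + (1 - f) * ((2 * \<beta> - 1) * s powr (2 * \<beta> - 2) + 3 * s powr (-4))"
  have der: "(BKO_P \<mu> \<rho> \<beta> f has_field_derivative \<mu> / \<rho> * D) (at \<Gamma>)"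
    using BKO_P_has_derivative[OF assms(1)] by (simp add: D_def s_def)
  \<comment> \<open>This positive factor clears the negative exponents of \<open>D\<close>: it turns
    \<open>s powr (-2 * \<beta> - 2)\<close> and \<open>s powr (-4)\<close> into the prefactors of A
    and B.\<close>
  define T where "T = s powr (2 * \<beta> + 4)"
  have s2: "s ^ 2 = s powr 2" using s by simp
  have "s powr (-2 * \<beta> - 2) * T = s ^ 2" "s powr (-4) * T = s powr (2 * \<beta>)"
    "T = s ^ 2 * s powr (2 * \<beta> + 2)"
    "s powr (2 * \<beta> - 2) * T = s powr (2 * \<beta>) * s powr (2 * \<beta> + 2)"
    by (simp_all add: T_def s2 powr_add[symmetric] add_ac)
  then have "D * T = f * BKO_A \<beta> s - (1 - f) * BKO_B \<beta> s"
    unfolding D_def BKO_A_def BKO_B_def by algebra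
  moreover have "D > 0 \<longleftrightarrow> D * T > 0"
    using s by (simp add: T_def zero_less_mult_iff)
  moreover have "\<mu> / \<rho> * D > 0 \<longleftrightarrow> D > 0"
    using assms by (simp add: zero_less_mult_iff zero_less_divide_iff)
  moreover have "p_system_hyperbolic_at (BKO_P \<mu> \<rho> \<beta> f) \<Gamma> \<longleftrightarrow> \<mu> / \<rho> * D > 0"
    using der DERIV_imp_deriv[OF der]
    by (auto simp: p_system_hyperbolic_at_def field_differentiable_def)
  ultimately show ?thesis by (simp add: s_def)
qed

lemma hyperbolicity_condition_BKO_P_iff:
  assumes "\<mu> > 0" "\<rho> > 0"
  shows "hyperbolicity_condition (BKO_P \<mu> \<rho> \<beta> f) \<longleftrightarrow>
    (\<forall>s>0. f * BKO_A \<beta> s > (1 - f) * BKO_B \<beta> s)"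
proof
  assume h: "hyperbolicity_condition (BKO_P \<mu> \<rho> \<beta> f)"
  show "\<forall>s>0. f * BKO_A \<beta> s > (1 - f) * BKO_B \<beta> s"
  proof (intro allI impI)
    fix s :: real assume "s > 0"
    then show "f * BKO_A \<beta> s > (1 - f) * BKO_B \<beta> s"
      using h p_system_hyperbolic_at_BKO_P_iff[of "s - 1" \<mu> \<rho> \<beta> f] assms
      by (simp add: hyperbolicity_condition_def)
  qed
qed (simp add: hyperbolicity_condition_def p_system_hyperbolic_at_BKO_P_iff assms)

text \<open>Signs alone decide here. This disposes of all s when \<beta> \<ge> 1/2, and of s up to
  \<open>BKO_s \<beta>\<close> otherwise.\<close>

lemma BKO_ineq_of_B_nonpos:
  assumes "s > 0" "\<beta> > 0" "0 < f" "f < 1" "BKO_B \<beta> s \<le> 0"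
  shows "f * BKO_A \<beta> s > (1 - f) * BKO_B \<beta> s"
proof -
  have "(1 - f) * BKO_B \<beta> s \<le> 0" using assms by (simp add: mult_nonneg_nonpos)
  also have "0 < f * BKO_A \<beta> s" using assms BKO_A_pos by simp
  finally show ?thesis .
qed

section \<open>Sign of B and bounds on Q for 0 < \<beta> < 1/2\<close>

context
  fixes \<beta> :: real
  assumes beta: "0 < \<beta>" "\<beta> < 1/2"
begin

lemma BKO_s_pos: "BKO_s \<beta> > 0"
  using beta by (simp add: BKO_s_def)

lemma BKO_s_powr: "BKO_s \<beta> powr (2 * \<beta> + 2) = 3 / (1 - 2 * \<beta>)"
  using beta by (simp add: BKO_s_def powr_powr)

text \<open>The bracket in B increases with s, and \<open>BKO_s \<beta>\<close> is by construction
  its positive root.\<close>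

lemma BKO_B_pos_iff:
  assumes "s > 0"
  shows "BKO_B \<beta> s > 0 \<longleftrightarrow> s > BKO_s \<beta>"
proof -
  have "BKO_B \<beta> s > 0 \<longleftrightarrow> 3 < (1 - 2 * \<beta>) * s powr (2 * \<beta> + 2)"
    using assms by (simp add: BKO_B_def zero_less_mult_iff)
  also have "\<dots> \<longleftrightarrow> s powr (2 * \<beta> + 2) > 3 / (1 - 2 * \<beta>)"
    using beta by (simp add: pos_divide_less_eq mult.commute)
  also have "\<dots> \<longleftrightarrow> s powr (2 * \<beta> + 2) > BKO_s \<beta> powr (2 * \<beta> + 2)"
    by (simp add: BKO_s_powr)
  also have "\<dots> \<longleftrightarrow> s > BKO_s \<beta>"
    using assms beta BKO_s_pos
    by (metis add_pos_pos less_eq_real_def mult_pos_pos not_less powr_less_mono2 zero_less_numeral)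
  finally show ?thesis .
qed

lemma BKO_B_at_BKO_s: "BKO_B \<beta> (BKO_s \<beta>) = 0"
proof -
  have "(1 - 2 * \<beta>) * (3 / (1 - 2 * \<beta>)) = 3"
    using beta by (intro nonzero_mult_div_cancel_left[THEN trans[OF times_divide_eq_right]]) simp
  then show ?thesis by (simp only: BKO_B_def BKO_s_powr diff_self mult_zero_right)
qed

lemma BKO_Q_at_BKO_s: "BKO_Q (BKO_s \<beta>) \<beta> = 0"
  by (simp add: BKO_Q_eq BKO_B_at_BKO_s)

lemma BKO_Q_pos:
  assumes "s > BKO_s \<beta>"
  shows "BKO_Q s \<beta> > 0"
  using assms BKO_s_pos beta BKO_B_pos_iff[of s] BKO_A_pos[of s \<beta>]
  by (simp add: BKO_Q_eq)

text \<open>Cross-multiplying reduces the claim to B s^(2-2\<beta>) < (1-2\<beta>) A. Both sides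
  then carry the factor s^2, and the cofactors differ only in -3 against the positive number
  (1-2\<beta>)(1+2\<beta>).\<close>

lemma BKO_Q_less:
  assumes "s > BKO_s \<beta>"
  shows "BKO_Q s \<beta> < (1 - 2 * \<beta>) / (1 - 2 * \<beta> + s powr (2 - 2 * \<beta>))"
proof -
  have s: "s > 0" using assms BKO_s_pos by linarith
  define a b k where "a = BKO_A \<beta> s" and "b = BKO_B \<beta> s" and "k = 1 - 2 * \<beta>"
  have a: "a > 0" and b: "b > 0" and k: "k > 0"
    using s assms beta BKO_A_pos BKO_B_pos_iff by (auto simp: a_def b_def k_def)
  have s2: "s ^ 2 = s powr 2" using s by simp
  have "b * s powr (2 - 2 * \<beta>) = s powr 2 * (k * s powr (2 * \<beta> + 2) - 3)"
    unfolding b_def BKO_B_def k_def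
    using powr_add[of s "2 * \<beta>" "2 - 2 * \<beta>"] by (simp add: mult_ac)
  also have "\<dots> < s powr 2 * (k * (1 + 2 * \<beta> + s powr (2 * \<beta> + 2)))"
  proof -
    have "k * (1 + 2 * \<beta>) > 0" using k beta by simp
    then have "k * s powr (2 * \<beta> + 2) - 3 < k * (1 + 2 * \<beta> + s powr (2 * \<beta> + 2))"
      by (simp only: distrib_left)
    then show ?thesis using s by (intro mult_strict_left_mono) auto
  qed
  also have "\<dots> = k * a"
    by (simp add: a_def BKO_A_def s2)
  finally have "b * s powr (2 - 2 * \<beta>) < k * a" .
  then have "b / (a + b) < k / (k + s powr (2 - 2 * \<beta>))"
    using a b k s by (simp add: field_simps add_pos_pos)
  then show ?thesis by (simp add: BKO_Q_eq a_def b_def k_def)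
qed

text \<open>The exponent 2-2\<beta> is positive. This turns the pointwise bound on Q into a uniform
  one on a whole tail, or into its value at \<open>BKO_s \<beta>\<close>.\<close>

lemma BKO_bound_antimono:
  assumes "0 < r" "r \<le> s"
  shows "(1 - 2 * \<beta>) / (1 - 2 * \<beta> + s powr (2 - 2 * \<beta>))
    \<le> (1 - 2 * \<beta>) / (1 - 2 * \<beta> + r powr (2 - 2 * \<beta>))"
proof -
  have "r powr (2 - 2 * \<beta>) \<le> s powr (2 - 2 * \<beta>)"
    using assms beta by (intro powr_mono2) auto
  moreover have "r powr (2 - 2 * \<beta>) > 0" using assms by simp
  ultimately show ?thesis using beta by (intro divide_left_mono mult_pos_pos add_pos_pos) auto
qed

section \<open>Existence of the maximum of Q\<close>

lemma continuous_on_BKO_Q: "continuous_on {BKO_s \<beta>..} (\<lambda>s. BKO_Q s \<beta>)"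
proof -
  \<comment> \<open>The endpoint is included so that compactness can be used later; B vanishes
    there, and to its right both summands are positive.\<close>
  have "BKO_A \<beta> s + BKO_B \<beta> s \<noteq> 0" if "s \<in> {BKO_s \<beta>..}" for s
  proof (cases "s = BKO_s \<beta>")
    case True
    then show ?thesis
      using BKO_A_pos[of s \<beta>] BKO_s_pos beta by (simp add: BKO_B_at_BKO_s)
  next
    case False
    then show ?thesis
      using that BKO_A_pos[of s \<beta>] BKO_B_pos_iff[of s] BKO_s_pos beta by auto
  qed
  moreover have "continuous_on {BKO_s \<beta>..} (BKO_A \<beta>)" "continuous_on {BKO_s \<beta>..} (BKO_B \<beta>)"
    unfolding BKO_A_def BKO_B_def using BKO_s_pos by (auto intro!: continuous_intros)
  ultimately show ?thesis unfolding BKO_Q_eq by (intro continuous_intros) auto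
qed

lemma BKO_Q_attains_max: "\<exists>s>BKO_s \<beta>. \<forall>t>BKO_s \<beta>. BKO_Q t \<beta> \<le> BKO_Q s \<beta>"
proof -
  \<comment> \<open>Any point of the open range would serve as r; its value q > 0 is the level that
    the tail must not exceed.\<close>
  define r where "r = BKO_s \<beta> + 1"
  define q where "q = BKO_Q r \<beta>"
  have q: "q > 0" using BKO_Q_pos[of r] by (simp add: q_def r_def)
  \<comment> \<open>The second entry makes M^(2-2\<beta>) \<ge> 1/q, which pushes the dominating
    function below q from M on; the first keeps r inside the compact interval.\<close>
  define M where "M = max r ((1 / q) powr (1 / (2 - 2 * \<beta>)))"
  have M: "M > 0" "r \<le> M" using BKO_s_pos by (auto simp: M_def r_def)
  have tail: "BKO_Q t \<beta> \<le> q" if "t > M" for t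
  proof -
    have t: "t > BKO_s \<beta>" using that M by (simp add: r_def)
    have "1 / q = ((1 / q) powr (1 / (2 - 2 * \<beta>))) powr (2 - 2 * \<beta>)"
      using q beta by (simp add: powr_powr)
    also have "\<dots> \<le> M powr (2 - 2 * \<beta>)"
      using beta by (intro powr_mono2) (auto simp: M_def)
    finally have "1 / q \<le> M powr (2 - 2 * \<beta>)" .
    then have "1 \<le> M powr (2 - 2 * \<beta>) * q" using q by (simp add: field_simps)
    \<comment> \<open>Here 1-2\<beta> < 1 \<le> q M^(2-2\<beta>), and the extra term q (1-2\<beta>)
      is positive.\<close>
    then have "1 - 2 * \<beta> \<le> q * (1 - 2 * \<beta> + M powr (2 - 2 * \<beta>))"
      using beta q by (simp add: distrib_left mult.commute) (smt (verit) mult_pos_pos)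
    then have "(1 - 2 * \<beta>) / (1 - 2 * \<beta> + M powr (2 - 2 * \<beta>)) \<le> q"
      using beta M by (simp add: pos_divide_le_eq add_pos_pos)
    then show ?thesis
      using BKO_Q_less[OF t] BKO_bound_antimono[of M t] M that by linarith
  qed
  have "\<exists>s\<in>{BKO_s \<beta>..M}. \<forall>t\<in>{BKO_s \<beta>..M}. BKO_Q t \<beta> \<le> BKO_Q s \<beta>"
    using M by (intro continuous_attains_sup continuous_on_subset[OF continuous_on_BKO_Q])
      (auto simp: r_def)
  then obtain s where s: "s \<in> {BKO_s \<beta>..M}"
      and sup: "\<And>t. t \<in> {BKO_s \<beta>..M} \<Longrightarrow> BKO_Q t \<beta> \<le> BKO_Q s \<beta>" by blast
  have qs: "q \<le> BKO_Q s \<beta>" unfolding q_def using M by (intro sup) (auto simp: r_def)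
  \<comment> \<open>The maximiser over the closed interval avoids the added endpoint, where Q is 0 <
    q.\<close>
  then have "s \<noteq> BKO_s \<beta>" using q BKO_Q_at_BKO_s by auto
  then have "s > BKO_s \<beta>" using s by simp
  moreover have "BKO_Q t \<beta> \<le> BKO_Q s \<beta>" if "t > BKO_s \<beta>" for t
    using tail[of t] qs sup[of t] that by (cases "t > M") auto
  ultimately show ?thesis by blast
qed

section \<open>The threshold \<open>BKO_f\<close> and its bounds\<close>

lemma BKO_f_is_max:
  "\<exists>s>BKO_s \<beta>. BKO_Q s \<beta> = BKO_f \<beta>"
  "s > BKO_s \<beta> \<Longrightarrow> BKO_Q s \<beta> \<le> BKO_f \<beta>"
proof -
  obtain m where m: "m > BKO_s \<beta>" "\<And>t. t > BKO_s \<beta> \<Longrightarrow> BKO_Q t \<beta> \<le> BKO_Q m \<beta>"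
    using BKO_Q_attains_max by blast
  \<comment> \<open>Attainment at m is what gives the \<open>GREATEST\<close> description its
    intended value.\<close>
  have "BKO_f \<beta> = BKO_Q m \<beta>"
    unfolding BKO_f_def using m by (intro Greatest_equality) auto
  then show "\<exists>s>BKO_s \<beta>. BKO_Q s \<beta> = BKO_f \<beta>"
    "s > BKO_s \<beta> \<Longrightarrow> BKO_Q s \<beta> \<le> BKO_f \<beta>"
    using m by auto
qed

text \<open>The strict bound applies at a maximiser, which lies to the right of
  \<open>BKO_s \<beta>\<close>; monotonicity then moves the bound to that endpoint.\<close>

lemma BKO_f_less: "BKO_f \<beta> < (1 - 2 * \<beta>) / (1 - 2 * \<beta> + BKO_s \<beta> powr (2 - 2 * \<beta>))"
proof -
  obtain m where m: "m > BKO_s \<beta>" "BKO_Q m \<beta> = BKO_f \<beta>"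
    using BKO_f_is_max(1) by blast
  then show ?thesis
    using BKO_Q_less[of m] BKO_bound_antimono[of "BKO_s \<beta>" m] BKO_s_pos by linarith
qed

lemma BKO_f_pos: "BKO_f \<beta> > 0"
  using BKO_f_is_max(1) BKO_Q_pos by metis

lemma BKO_f_less_1: "BKO_f \<beta> < 1"
proof -
  have "(1 - 2 * \<beta>) / (1 - 2 * \<beta> + BKO_s \<beta> powr (2 - 2 * \<beta>)) < 1"
    using beta BKO_s_pos by (simp add: add_pos_pos)
  then show ?thesis using BKO_f_less by linarith
qed

section \<open>Hyperbolicity as a condition on f\<close>

lemma BKO_ineq_iff_Q_less:
  assumes "s > BKO_s \<beta>"
  shows "f * BKO_A \<beta> s > (1 - f) * BKO_B \<beta> s \<longleftrightarrow> f > BKO_Q s \<beta>"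
proof -
  have "BKO_A \<beta> s + BKO_B \<beta> s > 0"
    using assms beta BKO_s_pos BKO_A_pos[of s \<beta>] BKO_B_pos_iff[of s] by simp
  \<comment> \<open>f A > (1-f) B rearranges to f (A+B) > B, and division by A+B > 0 gives
    Q.\<close>
  then show ?thesis by (simp add: BKO_Q_eq pos_divide_less_eq algebra_simps)
qed

lemma hyperbolicity_condition_BKO_P_iff_BKO_f:
  assumes "\<mu> > 0" "\<rho> > 0" "0 < f" "f < 1"
  shows "hyperbolicity_condition (BKO_P \<mu> \<rho> \<beta> f) \<longleftrightarrow> f > BKO_f \<beta>"
proof -
  have "(\<forall>s>0. f * BKO_A \<beta> s > (1 - f) * BKO_B \<beta> s) \<longleftrightarrow>
    (\<forall>s>BKO_s \<beta>. f * BKO_A \<beta> s > (1 - f) * BKO_B \<beta> s)"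
    using BKO_ineq_of_B_nonpos[OF _ beta(1) assms(3,4)] BKO_B_pos_iff BKO_s_pos
    by (meson less_trans not_less)
  also have "\<dots> \<longleftrightarrow> (\<forall>s>BKO_s \<beta>. f > BKO_Q s \<beta>)"
    using BKO_ineq_iff_Q_less by simp
  \<comment> \<open>The inequality stays strict because the maximum is attained; an unattained
    supremum would also admit equality.\<close>
  also have "\<dots> \<longleftrightarrow> f > BKO_f \<beta>"
    using BKO_f_is_max by (metis le_less_trans)
  finally show ?thesis by (simp add: hyperbolicity_condition_BKO_P_iff assms)
qed

end

text \<open>The coefficient 1-2\<beta> is now nonpositive, so B is never positive and no threshold
  for f arises.\<close>

lemma hyperbolicity_condition_BKO_P_of_ge_half:
  assumes "\<mu> > 0" "\<rho> > 0" "0 < f" "f < 1" "\<beta> \<ge> 1/2"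
  shows "hyperbolicity_condition (BKO_P \<mu> \<rho> \<beta> f)"
proof -
  have "BKO_B \<beta> s \<le> 0" for s
  proof -
    have "(1 - 2 * \<beta>) * s powr (2 * \<beta> + 2) \<le> 0"
      using assms(5) by (intro mult_nonpos_nonneg) auto
    then show ?thesis unfolding BKO_B_def by (intro mult_nonneg_nonpos) auto
  qed
  then show ?thesis
    using assms by (simp add: hyperbolicity_condition_BKO_P_iff BKO_ineq_of_B_nonpos)
qed

theorem mainTheorem8:
  fixes lam \<mu> \<rho>\<^sub>0 \<beta> f :: real
  assumes "lam > 0" and "\<mu> > 0" and "\<rho>\<^sub>0 > 0"
    and "\<beta> = lam / (2 * \<mu>)"
    and "0 < f" and "f < 1"
  shows "(\<beta> \<ge> 1/2 \<longrightarrow> hyperbolicity_condition (BKO_P \<mu> \<rho>\<^sub>0 \<beta> f)) \<and>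
    (0 < \<beta> \<and> \<beta> < 1/2 \<longrightarrow>
       (\<exists>s>BKO_s \<beta>. BKO_Q s \<beta> = BKO_f \<beta>) \<and>
       (\<forall>s>BKO_s \<beta>. BKO_Q s \<beta> \<le> BKO_f \<beta>) \<and>
       0 < BKO_f \<beta> \<and> BKO_f \<beta> < 1 \<and>
       (hyperbolicity_condition (BKO_P \<mu> \<rho>\<^sub>0 \<beta> f) \<longleftrightarrow> f > BKO_f \<beta>) \<and>
       BKO_f \<beta> \<le> (1 - 2 * \<beta>) / (1 - 2 * \<beta> + BKO_s \<beta> powr (2 - 2 * \<beta>)))"
  using hyperbolicity_condition_BKO_P_of_ge_half[OF assms(2,3,5,6)]
    BKO_f_is_max BKO_f_pos BKO_f_less_1 less_imp_le[OF BKO_f_less]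
    hyperbolicity_condition_BKO_P_iff_BKO_f[OF _ _ assms(2,3,5,6)]
  by (intro conjI impI allI) (elim conjE, assumption | blast)+

end
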